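(* Every exponential bottleneck game $\mathcal{R}=(G,\mathcal{N},\mathcal{P})$ has a Nash-routing.
   Context: A routing game is a tuple $\mathcal{R}=(G,\mathcal{N},\mathcal{P})$, where $G=(V,E)$ is a finite graph, $\mathcal{N}=\{1,\dots,N\}$ is a finite set of players, each player $i$ has a source $u_i\in V$ and a destination $v_i\in V$, and $\mathcal{P}=\bigcup_{i\in\mathcal{N}}\mathcal{P}_i$, where the strategy set $\mathcal{P}_i$ of player $i$ is a nonempty (otherwise arbitrary) collection of paths in $G$ from $u_i$ to $v_i$. $E(p)$ denotes the set of edges of a path $p$. A routing (pure strategy profile) is $\mathbf{p}=[p_1,\dots,p_N]$ with $p_i\in\mathcal{P}_i$ for every $i$. For a routing $\mathbf{p}$ and an edge $e$, the congestion $C_e(\mathbf{p})$ is the number of indices $i$ such that $p_i$ uses $e$. The game is an exponential bottleneck game (exponential game) if the social cost is $SC(\mathbf{p})=\max_{e\in E}C_e(\mathbf{p})$ and the cost of player $i$ is $pc_i(\mathbf{p})=\sum_{e\in E(p_i)}2^{C_e(\mathbf{p})}$; each player wants to minimize its cost. A routing $\mathbf{p}$ is a Nash-routing (pure Nash equilibrium) if for every player $i$ and every $p_i'\in\mathcal{P}_i$, $pc_i(\mathbf{p})\le pc_i(p_i';\mathbf{p}_{-i})$, where $(p_i';\mathbf{p}_{-i})$ is the routing obtained from $\mathbf{p}$ by replacing $p_i$ with $p_i'$. *)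

theory Defs
  imports "Graph_Theory.Pair_Digraph" "Graph_Theory.Vertex_Walk" "HOL-Library.FuncSet"
begin

text \<open>
  A finite simple undirected graph is a \<^const>\<open>pair_graph\<close>, i.e. a finite, loop-free, symmetric
  set of vertex pairs. The arcs \<open>(x, y)\<close> and \<open>(y, x)\<close> represent the same undirected edge,
  so that edges, and hence congestion, are taken over two-element sets \<open>{x, y}\<close>.
\<close>

definition edges :: "'v pair_pre_digraph \<Rightarrow> 'v set set" where
  "edges G = {{x, y} | x y. (x, y) \<in> parcs G}"

text \<open>
  \<^const>\<open>vpath\<close> requires a nonempty sequence of pairwise distinct vertices, consecutive ones being
  adjacent; the single-vertex path is allowed when source and destination coincide.
\<close>

definition path_between :: "'v pair_pre_digraph \<Rightarrow> 'v \<Rightarrow> 'v \<Rightarrow> 'v list \<Rightarrow> bool" where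
  "path_between G u v q \<longleftrightarrow> vpath q (with_proj G) \<and> hd q = u \<and> last q = v"

definition path_edges :: "'v list \<Rightarrow> 'v set set" where
  "path_edges q = {{x, y} | x y. (x, y) \<in> set (vwalk_arcs q)}"

record 'v routing_game =
  network :: "'v pair_pre_digraph"
  num_players :: nat
  source :: "nat \<Rightarrow> 'v"
  destination :: "nat \<Rightarrow> 'v"
  strategies :: "nat \<Rightarrow> 'v list set"

definition players :: "'v routing_game \<Rightarrow> nat set" where
  "players R = {1..num_players R}"

definition is_routing_game :: "'v routing_game \<Rightarrow> bool" where
  "is_routing_game R \<longleftrightarrow>
     pair_graph (network R) \<and>
     (\<forall>i\<in>players R.
        source R i \<in> pverts (network R) \<and> destination R i \<in> pverts (network R) \<and>
        strategies R i \<noteq> {} \<and>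
        (\<forall>q\<in>strategies R i. path_between (network R) (source R i) (destination R i) q))"

definition routings :: "'v routing_game \<Rightarrow> (nat \<Rightarrow> 'v list) set" where
  "routings R = (\<Pi>\<^sub>E i\<in>players R. strategies R i)"

definition congestion :: "'v routing_game \<Rightarrow> (nat \<Rightarrow> 'v list) \<Rightarrow> 'v set \<Rightarrow> nat" where
  "congestion R p e = card {i \<in> players R. e \<in> path_edges (p i)}"

text \<open>
  The social cost and the player costs are separate data of the game, since the equilibrium notion
  makes sense for arbitrary player costs. The maximum over an empty edge set is read as \<open>0\<close>.
\<close>

definition exponential_bottleneck_game ::
    "'v routing_game \<Rightarrow> ((nat \<Rightarrow> 'v list) \<Rightarrow> nat) \<Rightarrow> (nat \<Rightarrow> (nat \<Rightarrow> 'v list) \<Rightarrow> nat) \<Rightarrow> bool" where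
  "exponential_bottleneck_game R SC pc \<longleftrightarrow>
     is_routing_game R \<and>
     (\<forall>p\<in>routings R. SC p = Max (insert 0 (congestion R p ` edges (network R)))) \<and>
     (\<forall>p\<in>routings R. \<forall>i\<in>players R. pc i p = (\<Sum>e\<in>path_edges (p i). 2 ^ congestion R p e))"

definition Nash_routing ::
    "'v routing_game \<Rightarrow> (nat \<Rightarrow> (nat \<Rightarrow> 'v list) \<Rightarrow> nat) \<Rightarrow> (nat \<Rightarrow> 'v list) \<Rightarrow> bool" where
  "Nash_routing R pc p \<longleftrightarrow>
     p \<in> routings R \<and>
     (\<forall>i\<in>players R. \<forall>q\<in>strategies R i. pc i p \<le> pc i (p(i := q)))"

end

theory Submission
  imports Defs
begin

text \<open>
  The function \<open>p \<mapsto> \<Sum>e. 2 ^ C\<^sub>e(p)\<close> is a potential: letting player \<open>i\<close> join the others adds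
  \<open>2 ^ (C\<^sub>e - 1)\<close> on each edge of its path, which is half of what \<open>i\<close> pays there. Hence doubling the
  potential gives the cost of \<open>i\<close> plus a term independent of the strategy of \<open>i\<close>, and a routing of
  minimal potential is an equilibrium.
\<close>

text \<open>Since 2^1 + ... + 2^C = 2 * 2^C - 2, twice this sum is, up to an additive constant,
  Rosenthal's potential for edge delays 2^C.\<close>

definition potential :: "'v routing_game \<Rightarrow> (nat \<Rightarrow> 'v list) \<Rightarrow> nat" where
  "potential R p = (\<Sum>e\<in>edges (network R). 2 ^ congestion R p e)"

definition congestion_of_others :: "'v routing_game \<Rightarrow> nat \<Rightarrow> (nat \<Rightarrow> 'v list) \<Rightarrow> 'v set \<Rightarrow> nat" where
  "congestion_of_others R i p e = card {j \<in> players R - {i}. e \<in> path_edges (p j)}"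

lemma congestion_of_others_upd:
  "congestion_of_others R i (p(i := q)) = congestion_of_others R i p"
proof
  fix e
  have "{j \<in> players R - {i}. e \<in> path_edges ((p(i := q)) j)} =
      {j \<in> players R - {i}. e \<in> path_edges (p j)}"
    by auto
  then show "congestion_of_others R i (p(i := q)) e = congestion_of_others R i p e"
    by (simp add: congestion_of_others_def)
qed

lemma congestion_split:
  assumes "i \<in> players R"
  shows "congestion R p e =
    congestion_of_others R i p e + (if e \<in> path_edges (p i) then 1 else 0)"
proof -
  let ?O = "{j \<in> players R - {i}. e \<in> path_edges (p j)}"
  have "finite ?O" "i \<notin> ?O"
    by (auto simp: players_def)
  moreover have "{j \<in> players R. e \<in> path_edges (p j)} =
      (if e \<in> path_edges (p i) then insert i ?O else ?O)"
    using assms by auto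
  ultimately show ?thesis
    by (simp add: congestion_def congestion_of_others_def)
qed

lemma finite_edges:
  assumes "pair_graph G"
  shows "finite (edges G)"
proof -
  interpret pair_graph G by fact
  have "edges G = (\<lambda>(x, y). {x, y}) ` parcs G"
    by (auto simp: edges_def)
  then show ?thesis
    using pair_finite_arcs by simp
qed

text \<open>Ensures that the potential counts every edge that a player pays for.\<close>

lemma path_edges_subset_edges:
  assumes "path_between G u v q"
  shows "path_edges q \<subseteq> edges G"
proof -
  have "set (vwalk_arcs q) \<subseteq> parcs G"
    using assms by (auto simp: path_between_def vpath_def vwalk_def)
  then show ?thesis
    by (auto simp: path_edges_def edges_def)
qed

lemma potential_split:
  assumes game: "is_routing_game R" and p: "p \<in> routings R" and i: "i \<in> players R"
  shows "2 * potential R p =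
    2 * (\<Sum>e\<in>edges (network R). 2 ^ congestion_of_others R i p e) +
    (\<Sum>e\<in>path_edges (p i). 2 ^ congestion R p e)"
proof -
  let ?E = "edges (network R)"
  have fin: "finite ?E"
    using game finite_edges by (auto simp: is_routing_game_def)
  have "p i \<in> strategies R i"
    using p i by (auto simp: routings_def)
  then have sub: "path_edges (p i) \<subseteq> ?E"
    using game i path_edges_subset_edges by (fastforce simp: is_routing_game_def)
  \<comment> \<open>Edge by edge: if k other players use an edge on the path of \<open>i\<close>,
    then 2 * 2^(k+1) = 2 * 2^k + 2^(k+1); off that path the congestion is just k.\<close>
  have "2 * potential R p =
      (\<Sum>e\<in>?E. 2 * 2 ^ congestion_of_others R i p e +
        (if e \<in> path_edges (p i) then 2 ^ congestion R p e else 0))"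
    unfolding potential_def sum_distrib_left
    by (rule sum.cong) (auto simp: congestion_split[OF i])
  also have "\<dots> = 2 * (\<Sum>e\<in>?E. 2 ^ congestion_of_others R i p e) +
      (\<Sum>e\<in>?E \<inter> path_edges (p i). 2 ^ congestion R p e)"
    by (simp add: sum.distrib sum_distrib_left sum.inter_restrict[OF fin])
  finally show ?thesis
    using sub by (simp add: Int_absorb1)
qed

theorem mainTheorem2:
  fixes R :: "'v routing_game"
    and SC :: "(nat \<Rightarrow> 'v list) \<Rightarrow> nat"
    and pc :: "nat \<Rightarrow> (nat \<Rightarrow> 'v list) \<Rightarrow> nat"
  assumes "exponential_bottleneck_game R SC pc"
  shows "\<exists>p. Nash_routing R pc p"
proof -
  have game: "is_routing_game R"
    and pc: "\<And>p i. p \<in> routings R \<Longrightarrow> i \<in> players R \<Longrightarrow>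
      pc i p = (\<Sum>e\<in>path_edges (p i). 2 ^ congestion R p e)"
    using assms by (auto simp: exponential_bottleneck_game_def)
  have "routings R \<noteq> {}"
    using game by (auto simp: routings_def is_routing_game_def PiE_eq_empty_iff)
  \<comment> \<open>The potential takes natural values, so well-ordering yields a minimizer.\<close>
  then obtain p where p: "p \<in> routings R"
    and min: "\<And>q. q \<in> routings R \<Longrightarrow> potential R p \<le> potential R q"
    using ex_has_least_nat[of "\<lambda>p. p \<in> routings R" _ "potential R"] by blast
  have "pc i p \<le> pc i (p(i := q))" if i: "i \<in> players R" and q: "q \<in> strategies R i" for i q
  proof -
    \<comment> \<open>The update stays extensional because \<open>i\<close> is a player.\<close>
    have p': "p(i := q) \<in> routings R"
      using p i q by (auto simp: routings_def PiE_iff extensional_def)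
    \<comment> \<open>Both splittings share the term of the other players; cancelling it turns
      minimality of the potential into the cost inequality.\<close>
    show ?thesis
      using min[OF p'] potential_split[OF game p i] potential_split[OF game p' i]
        pc[OF p i] pc[OF p' i]
      by (simp add: congestion_of_others_upd)
  qed
  with p show ?thesis
    by (auto simp: Nash_routing_def)
qed

end
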